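(* For every integer $k\ge 1$, there is a split graph $S_k$ such that $\rho(S_k)=1$ and $\gamma(S_k)=k$.
   Context: All graphs are finite and simple. A graph is a split graph if its vertex set can be partitioned into two sets such that one of them induces a clique and the other one is an independent set. For a vertex $v$ of a graph $G$, $N_G[v]$ denotes the closed neighborhood of $v$. A dominating set of $G$ is a set of vertices whose closed neighborhoods together cover $V(G)$; $\gamma(G)$ denotes the minimum size of a dominating set. A packing in $G$ is a set of vertices whose closed neighborhoods are pairwise disjoint (equivalently, pairwise at distance at least $3$); $\rho(G)$ denotes the maximum size of a packing. *)

theory Defs
  imports Main "Graph_Theory.Pair_Digraph"
begin

text \<open>
  A finite simple graph is a \<^term>\<open>G\<close> with \<^term>\<open>pair_graph G\<close>: finite, loop-free and symmetric,
  an undirected edge being represented by its two arcs.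
\<close>

definition closed_nbhd :: "'a pair_pre_digraph \<Rightarrow> 'a \<Rightarrow> 'a set" where
  "closed_nbhd G v = insert v {u. (v, u) \<in> parcs G}"

definition is_clique :: "'a pair_pre_digraph \<Rightarrow> 'a set \<Rightarrow> bool" where
  "is_clique G K \<longleftrightarrow> K \<subseteq> pverts G \<and> (\<forall>u\<in>K. \<forall>v\<in>K. u \<noteq> v \<longrightarrow> (u, v) \<in> parcs G)"

definition is_independent :: "'a pair_pre_digraph \<Rightarrow> 'a set \<Rightarrow> bool" where
  "is_independent G I \<longleftrightarrow> I \<subseteq> pverts G \<and> (\<forall>u\<in>I. \<forall>v\<in>I. (u, v) \<notin> parcs G)"

text \<open>As usual, either part of the partition may be empty.\<close>

definition split_graph :: "'a pair_pre_digraph \<Rightarrow> bool" where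
  "split_graph G \<longleftrightarrow> pair_graph G \<and>
     (\<exists>K I. K \<union> I = pverts G \<and> K \<inter> I = {} \<and> is_clique G K \<and> is_independent G I)"

definition is_dominating :: "'a pair_pre_digraph \<Rightarrow> 'a set \<Rightarrow> bool" where
  "is_dominating G D \<longleftrightarrow> D \<subseteq> pverts G \<and> pverts G \<subseteq> (\<Union>v\<in>D. closed_nbhd G v)"

definition is_packing :: "'a pair_pre_digraph \<Rightarrow> 'a set \<Rightarrow> bool" where
  "is_packing G P \<longleftrightarrow> P \<subseteq> pverts G \<and>
     pairwise (\<lambda>u v. disjnt (closed_nbhd G u) (closed_nbhd G v)) P"

text \<open>
  For a finite graph both sets of cardinalities below are finite and nonempty, so \<^const>\<open>Min\<close> and
  \<^const>\<open>Max\<close> are attained; see the lemmas that follow.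
\<close>

definition domination_number :: "'a pair_pre_digraph \<Rightarrow> nat" where
  "domination_number G = Min (card ` {D. is_dominating G D})"

definition packing_number :: "'a pair_pre_digraph \<Rightarrow> nat" where
  "packing_number G = Max (card ` {P. is_packing G P})"

context pair_graph
begin

lemma finite_dominating: "finite {D. is_dominating G D}"
  by (rule finite_subset[OF _ finite_Pow_iff[THEN iffD2, OF pair_finite_verts]])
    (auto simp: is_dominating_def)

lemma finite_packing: "finite {P. is_packing G P}"
  by (rule finite_subset[OF _ finite_Pow_iff[THEN iffD2, OF pair_finite_verts]])
    (auto simp: is_packing_def)

lemma domination_number_attained: "\<exists>D. is_dominating G D \<and> card D = domination_number G"
proof -
  have "is_dominating G (pverts G)"
    by (auto simp: is_dominating_def closed_nbhd_def)
  then have "domination_number G \<in> card ` {D. is_dominating G D}"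
    unfolding domination_number_def using finite_dominating by (intro Min_in) auto
  then show ?thesis by auto
qed

lemma domination_number_le: "is_dominating G D \<Longrightarrow> domination_number G \<le> card D"
  unfolding domination_number_def using finite_dominating by (intro Min_le) auto

lemma packing_number_attained: "\<exists>P. is_packing G P \<and> card P = packing_number G"
proof -
  have "is_packing G {}"
    by (auto simp: is_packing_def)
  then have "packing_number G \<in> card ` {P. is_packing G P}"
    unfolding packing_number_def using finite_packing by (intro Max_in) auto
  then show ?thesis by auto
qed

lemma packing_number_ge: "is_packing G P \<Longrightarrow> card P \<le> packing_number G"
  unfolding packing_number_def using finite_packing by (intro Max_ge) auto

end

end

theory Submission
  imports Defs "HOL-Library.Nat_Bijection"
begin

text \<open>
  Take a clique on \<open>2k - 1\<close> vertices and, for every \<open>k\<close>-subset \<open>A\<close> of the clique, add one vertex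
  whose neighbourhood is \<open>A\<close>. The added vertices are independent, so the graph is split. Two
  \<open>k\<close>-subsets of a set with \<open>2k - 1\<close> elements meet, so any two closed neighbourhoods meet and a
  packing has at most one vertex. In a dominating set every added vertex can be replaced by one of
  its neighbours in the clique without losing the domination of the added vertices; the result is a
  subset of the clique that meets all \<open>k\<close>-subsets. A set of fewer than \<open>k\<close> clique vertices
  misses at least \<open>k\<close> others, hence misses some \<open>k\<close>-subset; conversely, any \<open>k\<close> clique vertices
  meet every \<open>k\<close>-subset and therefore dominate.

  The construction is carried out for an arbitrary family of sets of clique vertices: if the family
  is intersecting, the packing number is one, and if its members are nonempty, dominating sets can
  be turned into transversals that are no larger.
\<close>

text \<open>
  The split graph of a family \<open>F\<close> of subsets of \<open>{..<n}\<close>: the clique on \<open>{..<n}\<close> together with an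
  independent vertex for each \<open>A \<in> F\<close> that is adjacent to exactly the elements of \<open>A\<close>. The vertex
  for \<open>A\<close> is the number \<open>n + set_encode A\<close>; these numbers are distinct for distinct finite sets
  and avoid the clique.
\<close>

definition incidence_split_graph :: "nat \<Rightarrow> nat set set \<Rightarrow> nat pair_pre_digraph" where
  "incidence_split_graph n F =
     \<lparr> pverts = {..<n} \<union> (\<lambda>A. n + set_encode A) ` F,
       parcs = {(i, j). i < n \<and> j < n \<and> i \<noteq> j}
         \<union> {(i, n + set_encode A) | i A. A \<in> F \<and> i \<in> A}
         \<union> {(n + set_encode A, i) | i A. A \<in> F \<and> i \<in> A} \<rparr>"

context
  fixes n :: nat and F :: "nat set set"
  assumes F_subset: "\<And>A. A \<in> F \<Longrightarrow> A \<subseteq> {..<n}"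
begin

lemma set_encode_eq_iff_family:
  assumes "A \<in> F" "B \<in> F"
  shows "set_encode A = set_encode B \<longleftrightarrow> A = B"
  using assms F_subset by (auto simp: set_encode_eq finite_subset[OF F_subset])

lemma finite_family: "finite F"
  by (rule finite_subset[of _ "Pow {..<n}"]) (use F_subset in auto)

lemma split_graph_incidence: "split_graph (incidence_split_graph n F)"
proof -
  let ?G = "incidence_split_graph n F"
  have in_family: "i < n" if "A \<in> F" "i \<in> A" for A i
    using that F_subset by auto
  have not_in_family: "n + set_encode A \<notin> A" if "A \<in> F" for A
    using in_family[OF that, of "n + set_encode A"] by auto
  have arcs_in_verts: "parcs ?G \<subseteq> pverts ?G \<times> pverts ?G"
    using in_family by (auto simp: incidence_split_graph_def)
  have finite_verts: "finite (pverts ?G)"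
    using finite_family by (simp add: incidence_split_graph_def)
  have "pair_graph ?G"
  proof unfold_locales
    show "finite (pverts ?G)" by (rule finite_verts)
    show "finite (parcs ?G)"
      using arcs_in_verts finite_verts by (auto intro: finite_subset)
    show "fst e \<in> pverts ?G" "snd e \<in> pverts ?G" if "e \<in> parcs ?G" for e
      using that arcs_in_verts by auto
    show "fst e \<noteq> snd e" if "e \<in> parcs ?G" for e
      using that not_in_family by (auto simp: incidence_split_graph_def)
    show "symmetric ?G"
      by (auto simp: symmetric_def arcs_ends_def arc_to_ends_def incidence_split_graph_def
          intro!: symI)
  qed
  moreover have "is_clique (incidence_split_graph n F) {..<n}"
    by (auto simp: is_clique_def incidence_split_graph_def)
  moreover have "is_independent (incidence_split_graph n F) ((\<lambda>A. n + set_encode A) ` F)"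
    using F_subset by (force simp: is_independent_def incidence_split_graph_def)
  moreover have "{..<n} \<union> (\<lambda>A. n + set_encode A) ` F = pverts (incidence_split_graph n F)"
    by (simp add: incidence_split_graph_def)
  moreover have "{..<n} \<inter> (\<lambda>A. n + set_encode A) ` F = {}"
    by auto
  ultimately show ?thesis
    unfolding split_graph_def by blast
qed

lemma clique_subset_closed_nbhd:
  assumes "i < n"
  shows "{..<n} \<subseteq> closed_nbhd (incidence_split_graph n F) i"
  using assms by (auto simp: closed_nbhd_def incidence_split_graph_def)

lemma closed_nbhd_family:
  assumes "A \<in> F"
  shows "closed_nbhd (incidence_split_graph n F) (n + set_encode A) = insert (n + set_encode A) A"
  using assms F_subset
  by (auto simp: closed_nbhd_def incidence_split_graph_def set_encode_eq_iff_family)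

lemma packing_number_incidence:
  assumes "n > 0"
    and intersecting: "\<And>A B. A \<in> F \<Longrightarrow> B \<in> F \<Longrightarrow> A \<inter> B \<noteq> {}"
  shows "packing_number (incidence_split_graph n F) = 1"
proof -
  let ?G = "incidence_split_graph n F"
  interpret pair_graph ?G
    using split_graph_incidence by (simp add: split_graph_def)
  have trace: "\<exists>A. A \<subseteq> closed_nbhd ?G v \<and> (A = {..<n} \<or> A \<in> F)" if "v \<in> pverts ?G" for v
  proof (cases "v < n")
    case True
    then show ?thesis using clique_subset_closed_nbhd by blast
  next
    case False
    then obtain A where "A \<in> F" "v = n + set_encode A"
      using \<open>v \<in> pverts ?G\<close> by (auto simp: incidence_split_graph_def)
    then show ?thesis using closed_nbhd_family by blast
  qed
  have meet: "A \<inter> B \<noteq> {}" if "A = {..<n} \<or> A \<in> F" "B = {..<n} \<or> B \<in> F" for A B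
    using that \<open>n > 0\<close> intersecting F_subset
    by (metis Int_absorb1 Int_absorb2 Int_absorb lessThan_empty_iff not_less_zero
        bot_nat_0.not_eq_extremum)
  have not_disjoint: "\<not> disjnt (closed_nbhd ?G u) (closed_nbhd ?G v)"
    if uv: "u \<in> pverts ?G" "v \<in> pverts ?G" for u v
  proof -
    obtain A B where "A \<subseteq> closed_nbhd ?G u" "B \<subseteq> closed_nbhd ?G v" "A \<inter> B \<noteq> {}"
      using trace[OF uv(1)] trace[OF uv(2)] meet by metis
    then show ?thesis by (auto simp: disjnt_def)
  qed
  have "card P \<le> 1" if "is_packing ?G P" for P
  proof -
    have "\<forall>u\<in>P. \<forall>v\<in>P. u = v"
      using that not_disjoint unfolding is_packing_def pairwise_def by blast
    then show ?thesis
      by (metis One_nat_def card_le_Suc0_iff_eq card.infinite le0)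
  qed
  moreover have "is_packing ?G {0}"
    using \<open>n > 0\<close> by (simp add: is_packing_def incidence_split_graph_def)
  ultimately show ?thesis
    using packing_number_attained packing_number_ge[of "{0}"] by force
qed

lemma transversal_dominating:
  assumes "T \<subseteq> {..<n}" "T \<noteq> {}" and hits: "\<And>A. A \<in> F \<Longrightarrow> A \<inter> T \<noteq> {}"
  shows "is_dominating (incidence_split_graph n F) T"
proof -
  let ?G = "incidence_split_graph n F"
  have "{..<n} \<subseteq> (\<Union>v\<in>T. closed_nbhd ?G v)"
    using assms clique_subset_closed_nbhd by blast
  moreover have "n + set_encode A \<in> (\<Union>v\<in>T. closed_nbhd ?G v)" if "A \<in> F" for A
    using hits[OF that] that by (auto simp: closed_nbhd_def incidence_split_graph_def)
  ultimately show ?thesis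
    using assms(1) by (auto simp: is_dominating_def incidence_split_graph_def)
qed

lemma dominating_imp_transversal:
  assumes dom: "is_dominating (incidence_split_graph n F) D" and nonempty: "{} \<notin> F"
  obtains T where "T \<subseteq> {..<n}" "card T \<le> card D" "\<And>A. A \<in> F \<Longrightarrow> A \<inter> T \<noteq> {}"
proof -
  let ?G = "incidence_split_graph n F"
  have verts: "D \<subseteq> {..<n} \<union> (\<lambda>A. n + set_encode A) ` F"
    using dom by (simp add: is_dominating_def incidence_split_graph_def)
  \<comment> \<open>Clique vertices stay put, and the vertex for \<open>A\<close> moves to some element of \<open>A\<close>.\<close>
  define f where "f v = (if v < n then v else SOME i. i \<in> set_decode (v - n))" for v
  have f_family: "f (n + set_encode A) \<in> A" if "A \<in> F" for A
  proof -
    have "finite A" "A \<noteq> {}"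
      using that F_subset nonempty by (auto intro: finite_subset)
    then show ?thesis
      by (auto simp: f_def set_encode_inverse intro: someI)
  qed
  show thesis
  proof (rule that[of "f ` D"])
    show "f ` D \<subseteq> {..<n}"
    proof
      fix i assume "i \<in> f ` D"
      then obtain v where v: "v \<in> D" "i = f v" by blast
      show "i \<in> {..<n}"
      proof (cases "v < n")
        case True
        then show ?thesis using v by (simp add: f_def)
      next
        case False
        then obtain A where "A \<in> F" "v = n + set_encode A" using v verts by auto
        then show ?thesis using f_family F_subset v by blast
      qed
    qed
    have "finite D"
      using verts finite_family by (auto intro: finite_subset)
    then show "card (f ` D) \<le> card D" by (rule card_image_le)
    show "A \<inter> f ` D \<noteq> {}" if A: "A \<in> F" for A
    proof -
      obtain v where v: "v \<in> D" "n + set_encode A \<in> closed_nbhd ?G v"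
        using dom A by (auto simp: is_dominating_def incidence_split_graph_def)
      then have "v = n + set_encode A \<or> v \<in> A \<and> v < n"
        using A F_subset
        by (fastforce simp: closed_nbhd_def incidence_split_graph_def set_encode_eq_iff_family)
      then have "f v \<in> A"
        using f_family[OF A] by (auto simp: f_def)
      then show ?thesis using v by blast
    qed
  qed
qed

end

theorem theorem1p13:
  fixes k :: nat
  assumes "k \<ge> 1"
  shows "\<exists>S :: nat pair_pre_digraph. split_graph S \<and> packing_number S = 1 \<and> domination_number S = k"
proof -
  define n where "n = 2 * k - 1"
  define F where "F = {A. A \<subseteq> {..<n} \<and> card A = k}"
  let ?G = "incidence_split_graph n F"
  have n: "n > 0" "k \<le> n" "n < k + k"
    using assms by (auto simp: n_def)
  have F_subset: "A \<subseteq> {..<n}" if "A \<in> F" for A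
    using that by (simp add: F_def)
  have nonempty: "{} \<notin> F"
    using assms by (auto simp: F_def)
  have split: "split_graph ?G"
    using split_graph_incidence[OF F_subset] .
  \<comment> \<open>This also makes \<open>{..<k}\<close>, being itself a \<open>k\<close>-subset, a transversal of \<open>F\<close>.\<close>
  have meet: "A \<inter> B \<noteq> {}" if "A \<subseteq> {..<n}" "B \<subseteq> {..<n}" "card A = k" "card B = k" for A B
  proof
    assume "A \<inter> B = {}"
    moreover have "finite A" "finite B"
      using that by (auto intro: finite_subset)
    ultimately have "card (A \<union> B) = k + k"
      using that by (simp add: card_Un_disjoint)
    moreover have "card (A \<union> B) \<le> n"
      using card_mono[of "{..<n}" "A \<union> B"] that by simp
    ultimately show False using n by simp
  qed
  have packing: "packing_number ?G = 1"
    by (rule packing_number_incidence[OF F_subset n(1)]) (use meet in \<open>auto simp: F_def\<close>)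
  interpret pair_graph ?G
    using split by (simp add: split_graph_def)
  have "is_dominating ?G {..<k}"
  proof (rule transversal_dominating[OF F_subset])
    show "{..<k} \<subseteq> {..<n}" using n by auto
    show "{..<k} \<noteq> {}" using assms by (simp add: lessThan_empty_iff)
    show "A \<inter> {..<k} \<noteq> {}" if "A \<in> F" for A
      using that meet[of A "{..<k}"] n by (auto simp: F_def)
  qed
  then have upper: "domination_number ?G \<le> k"
    using domination_number_le by fastforce
  have lower: "k \<le> card D" if D: "is_dominating ?G D" for D
  proof (rule ccontr)
    assume "\<not> k \<le> card D"
    obtain T where T: "T \<subseteq> {..<n}" "card T \<le> card D" "\<And>A. A \<in> F \<Longrightarrow> A \<inter> T \<noteq> {}"
      using dominating_imp_transversal[OF F_subset D nonempty] by blast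
    have "card ({..<n} - T) = n - card T"
      using T(1) by (simp add: card_Diff_subset finite_subset)
    then have "k \<le> card ({..<n} - T)"
      using T(2) \<open>\<not> k \<le> card D\<close> by (simp add: n_def)
    then obtain A where "A \<subseteq> {..<n} - T" "card A = k"
      by (meson obtain_subset_with_card_n)
    then show False using T(3)[of A] by (auto simp: F_def)
  qed
  show ?thesis
    using split packing upper lower domination_number_attained by (metis le_antisym)
qed

end
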